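(* Let $s\ge n\ge1$ be integers and let $M\in\mathbf{C}^{s\times n}$ with singular values $\sigma_1\ge\cdots\ge\sigma_n\ge0$. Let $a_k=a_k(M)$, $g_k=g_k(M)$ and $s_k$ be as defined in the context. 1. If there is an integer $m'$ with $1\le m'\le n$ and $a_{m'}<1/9$, let $m$ be the smallest integer between $1$ and $n$ with $a_m<1/9$. Then $M$ has $\varepsilon$-rank $n-m$ with $$\varepsilon=\frac{3a_m+1-\sqrt{(3a_m+1)^2-16a_m}}{4g_m}.$$ 2. If $a_1>1/9$, then the $\varepsilon$-rank of $M$ is $n$ for $\varepsilon=\frac{1}{10\,g_m}$, where $m$ is the integer such that $s_{n-k}=0$ for $k=1,\dots,m-1$ and $s_{n-m}\ne0$.
   Context: $\varepsilon$-rank: for $\varepsilon\ge0$, the matrix $M$ has $\varepsilon$-rank equal to $r_\varepsilon$ if $\sigma_1\ge\cdots\ge\sigma_{r_\varepsilon}>\varepsilon\ge\sigma_{r_\varepsilon+1}\ge\cdots\ge\sigma_n$. For $k=1,\dots,n$, $s_k=\sum_{1\le i_1<\cdots<i_k\le n}\sigma_{i_1}\cdots\sigma_{i_k}$, and $s_0=1$. For those $k$ with $s_{n-k}\ne0$ define $$b_k(M)=\sup_{0\le i\le k-1}\Big(\frac{s_{n-i}}{s_{n-k}}\Big)^{\frac1{k-i}}\ (1\le k\le n),\qquad g_k(M)=\sup_{k+1\le i\le n}\Big(\frac{s_{n-i}}{s_{n-k}}\Big)^{\frac1{i-k}}\ (1\le k\le n-1),\qquad g_n(M)=1,$$ and $a_k(M)=b_k(M)\,g_k(M)$.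 A condition on $a_k$ (such as $a_k<1/9$ or $a_k>1/9$) presupposes $s_{n-k}\ne0$. *)

theory Defs
  imports
    "Jordan_Normal_Form.Schur_Decomposition"
    "HOL-Computational_Algebra.Fundamental_Theorem_Algebra"
begin

(* M^* M is Hermitian and positive semidefinite, so the roots of its characteristic
   polynomial (with multiplicity) are real and nonnegative and taking Re loses nothing. *)
definition singular_values :: "complex mat \<Rightarrow> real list" where
  "singular_values M =
     rev (sorted_list_of_multiset
       (image_mset (\<lambda>z. sqrt (Re z)) (proots (char_poly (mat_adjoint M * M)))))"

(* indexed from 1, in decreasing order *)
definition sing_val :: "complex mat \<Rightarrow> nat \<Rightarrow> real" where
  "sing_val M i = singular_values M ! (i - 1)"

definition has_eps_rank :: "complex mat \<Rightarrow> real \<Rightarrow> nat \<Rightarrow> bool" where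
  "has_eps_rank M \<epsilon> r \<longleftrightarrow>
     0 \<le> \<epsilon> \<and> r \<le> dim_col M \<and>
     (\<forall>i\<in>{1..r}. sing_val M i > \<epsilon>) \<and>
     (\<forall>i\<in>{r + 1..dim_col M}. \<epsilon> \<ge> sing_val M i)"

definition sym_sv :: "complex mat \<Rightarrow> nat \<Rightarrow> real" where
  "sym_sv M k = (\<Sum>I\<in>{I. I \<subseteq> {1..dim_col M} \<and> card I = k}. \<Prod>i\<in>I. sing_val M i)"

(* b_coeff, g_coeff and a_coeff are meaningful only for 1 <= k <= n = dim_col M
   with sym_sv M (n - k) nonzero; statements using them carry this as a hypothesis. *)
definition b_coeff :: "complex mat \<Rightarrow> nat \<Rightarrow> real" where
  "b_coeff M k = (let n = dim_col M in
     SUP i\<in>{0..k - 1}. (sym_sv M (n - i) / sym_sv M (n - k)) powr (1 / real (k - i)))"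

definition g_coeff :: "complex mat \<Rightarrow> nat \<Rightarrow> real" where
  "g_coeff M k = (let n = dim_col M in
     if k = n then 1
     else SUP i\<in>{k + 1..n}. (sym_sv M (n - i) / sym_sv M (n - k)) powr (1 / real (i - k)))"

definition a_coeff :: "complex mat \<Rightarrow> nat \<Rightarrow> real" where
  "a_coeff M k = b_coeff M k * g_coeff M k"

end

(* Write c_i = s_{n-i}, the coefficient of x^i in prod_j (x + sigma_j). If a_m < 1/9, comparing with
   geometric series of ratios b_m / r and g_m r shows that at r = epsilon the term c_m r^m exceeds
   half of the whole sum. No appeal to Rouche's theorem is needed since all roots are real: the
   numbers c_i r^i / prod_j (r + sigma_j) are the distribution of the number of successes in
   independent trials with success probabilities r / (r + sigma_j), and induction on the number
   of trials shows that a value taken with probability greater than 1/2 equals the number of trials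
   with success probability greater than 1/2, that is, the number of sigma_j < r; moreover no
   sigma_j equals r. If a_1 > 1/9, the bound c_0 <= sigma_n c_1 gives sigma_n >= b_1 = a_1 / g_1. *)

theory Submission
  imports Defs
begin

section \<open>Elementary symmetric sums and the success-count argument\<close>

text \<open>The index set is arbitrary so that induction can add one index at a time;
  \<open>sym_sv\<close> is the instance with \<open>{1..n}\<close>.\<close>

definition esym :: "'a set \<Rightarrow> ('a \<Rightarrow> real) \<Rightarrow> nat \<Rightarrow> real" where
  "esym S f k = (\<Sum>I\<in>{I. I \<subseteq> S \<and> card I = k}. \<Prod>i\<in>I. f i)"

lemma esym_0 [simp]: "finite S \<Longrightarrow> esym S f 0 = 1"
proof -
  assume "finite S"
  then have "{I. I \<subseteq> S \<and> card I = 0} = {{}}"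
    by (auto simp: card_eq_0_iff dest: finite_subset)
  then show ?thesis by (simp add: esym_def)
qed

text \<open>Subsets are split by whether they contain \<open>x\<close>; deleting \<open>x\<close>
  matches those that do with the \<open>k\<close>-subsets of \<open>S\<close>.\<close>

lemma esym_insert:
  assumes "finite S" "x \<notin> S"
  shows "esym (insert x S) f (Suc k) = esym S f (Suc k) + f x * esym S f k"
proof -
  let ?A = "{I. I \<subseteq> S \<and> card I = Suc k}" and ?B = "{I. I \<subseteq> S \<and> card I = k}"
  have fin: "finite ?A" "finite ?B" using assms(1) by auto
  have finI: "finite I" "x \<notin> I" if "I \<subseteq> S" for I
    using that assms by (auto dest: finite_subset)
  have eq: "{I. I \<subseteq> insert x S \<and> card I = Suc k} = ?A \<union> insert x ` ?B"
  proof (intro equalityI subsetI)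
    fix I assume I: "I \<in> {I. I \<subseteq> insert x S \<and> card I = Suc k}"
    show "I \<in> ?A \<union> insert x ` ?B"
    proof (cases "x \<in> I")
      case True
      then have "I = insert x (I - {x})" by auto
      moreover have "I - {x} \<in> ?B" using I True by auto
      ultimately show ?thesis by blast
    qed (use I in auto)
  qed (auto simp: finI)
  have inj: "inj_on (insert x) ?B"
  proof (rule inj_onI)
    fix I J assume "I \<in> ?B" "J \<in> ?B" "insert x I = insert x J"
    then show "I = J" using finI(2)[of I] finI(2)[of J] by (simp add: insert_ident)
  qed
  have "(\<Sum>I\<in>insert x ` ?B. prod f I) = (\<Sum>I\<in>?B. f x * prod f I)"
    by (subst sum.reindex[OF inj]) (auto intro!: sum.cong simp: finI)
  moreover have "?A \<inter> insert x ` ?B = {}" using finI by blast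
  ultimately show ?thesis
    unfolding esym_def eq using fin by (simp add: sum.union_disjoint sum_distrib_left)
qed

lemma esym_nonneg:
  assumes "\<And>i. i \<in> S \<Longrightarrow> 0 \<le> f i"
  shows "0 \<le> esym S f k"
  unfolding esym_def using assms by (intro sum_nonneg prod_nonneg) auto

lemma esym_eq_0:
  assumes "finite S" "card S < k"
  shows "esym S f k = 0"
proof -
  have "{I. I \<subseteq> S \<and> card I = k} = {}" using assms card_mono[OF assms(1)] by (auto simp: not_le[symmetric])
  then show ?thesis unfolding esym_def by (simp only: sum.empty)
qed

lemma esym_card:
  assumes "finite S"
  shows "esym S f (card S) = prod f S"
proof -
  have "{I. I \<subseteq> S \<and> card I = card S} = {S}" using assms card_subset_eq by auto
  then show ?thesis unfolding esym_def by simp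
qed

text \<open>Expanding the product gives one term per subset, grouped here by cardinality. For
  nonnegative \<open>f\<close>, dividing \<open>esym S f k\<close> by it yields the probability of
  \<open>k\<close> successes when trial \<open>i\<close> has odds \<open>f i\<close>.\<close>

lemma sum_esym:
  assumes "finite S"
  shows "(\<Sum>k\<le>card S. esym S f k) = (\<Prod>i\<in>S. 1 + f i)"
proof -
  have "(\<Prod>i\<in>S. 1 + f i) = (\<Sum>I\<in>Pow S. prod f I)"
    using prod_add[OF assms, of f "\<lambda>_. 1"] by (simp add: add.commute)
  also have "\<dots> = (\<Sum>k\<le>card S. sum (prod f) {I \<in> Pow S. card I = k})"
    using assms by (intro sum.group[symmetric]) (auto intro: card_mono)
  finally show ?thesis by (simp add: esym_def)
qed

lemma esym_scale: "esym S (\<lambda>i. c * f i) k = c ^ k * esym S f k"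
  unfolding esym_def by (simp add: sum_distrib_left prod.distrib)

text \<open>Two distinct success counts have total probability at most 1.\<close>

lemma esym_add_le:
  assumes "finite S" "\<And>i. i \<in> S \<Longrightarrow> 0 \<le> f i"
  shows "esym S f k + esym S f (Suc k) \<le> (\<Prod>i\<in>S. 1 + f i)"
proof (cases "Suc k \<le> card S")
  case True
  have "esym S f k + esym S f (Suc k) = (\<Sum>j\<in>{k, Suc k}. esym S f j)" by simp
  also have "\<dots> \<le> (\<Sum>j\<le>card S. esym S f j)"
    using True assms by (intro sum_mono2) (auto intro: esym_nonneg)
  finally show ?thesis using sum_esym[OF assms(1)] by simp
next
  case False
  have "esym S f k \<le> (\<Sum>j\<le>card S. esym S f j)"
  proof (cases "k \<le> card S")
    case True
    then show ?thesis using assms by (intro member_le_sum) (auto intro: esym_nonneg)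
  next
    case False
    then show ?thesis using assms by (auto simp: esym_eq_0 intro!: sum_nonneg esym_nonneg)
  qed
  then show ?thesis using False sum_esym[OF assms(1)] assms(1) by (simp add: esym_eq_0)
qed

text \<open>Conditioning on trial \<open>x\<close> mixes the probabilities of \<open>k\<close> and
  \<open>k - 1\<close> successes among the rest. If \<open>k < ?c\<close>, induction bounds both by
  1/2. Otherwise \<open>k = ?c\<close> and \<open>1 \<le> f x\<close>: induction bounds only the
  value \<open>k - 1\<close>, which has the larger weight, and \<open>esym_add_le\<close> covers the
  other.\<close>

lemma esym_le_half_of_few:
  assumes "finite S" "\<And>i. i \<in> S \<Longrightarrow> 0 \<le> f i" "k < card {i\<in>S. 1 \<le> f i}"
  shows "2 * esym S f k \<le> (\<Prod>i\<in>S. 1 + f i)"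
  using assms
proof (induction S arbitrary: k rule: finite_induct)
  case empty
  then show ?case by simp
next
  case (insert x S)
  let ?T = "\<Prod>i\<in>S. 1 + f i" and ?c = "card {i\<in>S. 1 \<le> f i}"
  have fin: "finite {i\<in>S. 1 \<le> f i}" using insert by auto
  have f: "0 \<le> f x" "\<And>i. i \<in> S \<Longrightarrow> 0 \<le> f i" using insert by auto
  have T1: "1 \<le> ?T" using f by (intro prod_ge_1) auto
  have IH: "2 * esym S f j \<le> ?T" if "j < ?c" for j
    using insert.IH[of j] f that by auto
  have T: "(\<Prod>i\<in>insert x S. 1 + f i) = ?T + f x * ?T"
    using insert by (simp add: algebra_simps)
  show ?case
  proof (cases "k < ?c")
    case True
    show ?thesis
    proof (cases k)
      case 0
      have "2 * esym S f 0 \<le> ?T" using IH True 0 by blast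
      moreover have "0 \<le> f x * ?T" using f T1 by simp
      moreover have "esym S f 0 = 1" "esym (insert x S) f 0 = 1" using insert(1) by simp_all
      ultimately show ?thesis unfolding T 0 by linarith
    next
      case (Suc j)
      have "f x * (2 * esym S f j) \<le> f x * ?T"
        using IH[of j] True Suc f by (intro mult_left_mono) auto
      then show ?thesis using IH[of k] True insert(1,2)
        unfolding T Suc esym_insert[OF insert(1,2)] by simp
    qed
  next
    case False
    have *: "{i \<in> insert x S. 1 \<le> f i} = (if 1 \<le> f x then insert x {i\<in>S. 1 \<le> f i} else {i\<in>S. 1 \<le> f i})"
      by auto
    have fx: "1 \<le> f x" and k: "k = ?c"
      using insert.prems(2) False fin insert(2) unfolding * by (auto split: if_splits)
    have fT: "?T \<le> f x * ?T" using mult_right_mono[OF fx, of ?T] T1 by simp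
    show ?thesis
    proof (cases k)
      case 0
      have "esym (insert x S) f 0 = 1" using insert(1) by simp
      then show ?thesis using T1 fT unfolding T 0 by linarith
    next
      case (Suc j)
      \<comment> \<open>Twice the new sum is \<open>2 * (esym S f j + esym S f (Suc j)) + (f x - 1)
        * (2 * esym S f j)\<close>, hence at most \<open>2 * ?T + (f x - 1) * ?T\<close>.\<close>
      have "(f x - 1) * (2 * esym S f j) \<le> (f x - 1) * ?T"
        using IH[of j] Suc k fx by (intro mult_left_mono) auto
      moreover have "esym S f j + esym S f (Suc j) \<le> ?T"
        using f insert(1) by (intro esym_add_le) auto
      ultimately show ?thesis
        unfolding T Suc esym_insert[OF insert(1,2)] by (simp add: algebra_simps)
    qed
  qed
qed

text \<open>Mirror image of \<open>esym_le_half_of_few\<close>, with success and failure exchanged;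
  accordingly the count uses \<open>1 < f i\<close>.\<close>

lemma esym_le_half_of_many:
  assumes "finite S" "\<And>i. i \<in> S \<Longrightarrow> 0 \<le> f i" "card {i\<in>S. 1 < f i} < k"
  shows "2 * esym S f k \<le> (\<Prod>i\<in>S. 1 + f i)"
  using assms
proof (induction S arbitrary: k rule: finite_induct)
  case empty
  then show ?case by (simp add: esym_eq_0)
next
  case (insert x S)
  let ?T = "\<Prod>i\<in>S. 1 + f i" and ?c = "card {i\<in>S. 1 < f i}"
  have fin: "finite {i\<in>S. 1 < f i}" using insert by auto
  have f: "0 \<le> f x" "\<And>i. i \<in> S \<Longrightarrow> 0 \<le> f i" using insert by auto
  have IH: "2 * esym S f j \<le> ?T" if "?c < j" for j
    using insert.IH[of j] f that by auto
  have T: "(\<Prod>i\<in>insert x S. 1 + f i) = ?T + f x * ?T"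
    using insert by (simp add: algebra_simps)
  have *: "{i \<in> insert x S. 1 < f i} = (if 1 < f x then insert x {i\<in>S. 1 < f i} else {i\<in>S. 1 < f i})"
    by auto
  obtain j where k: "k = Suc j" using insert.prems by (cases k) auto
  have k': "2 * esym S f (Suc j) \<le> ?T"
    using insert.prems(2) fin insert(2) unfolding * k by (intro IH) (auto split: if_splits)
  show ?case
  proof (cases "?c < j")
    case True
    have "f x * (2 * esym S f j) \<le> f x * ?T"
      using IH[OF True] f by (intro mult_left_mono) auto
    then show ?thesis using k' unfolding T k esym_insert[OF insert(1,2)] by simp
  next
    case False
    then have fx: "f x \<le> 1"
      using insert.prems(2) fin insert(2) unfolding * k by (auto split: if_splits)
    \<comment> \<open>With \<open>f x \<le> 1\<close> the nonnegative weights are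
      \<open>1 - f x\<close> on the inductive bound and \<open>2 * f x\<close> on
      \<open>esym_add_le\<close>.\<close>
    have "(1 - f x) * (2 * esym S f (Suc j)) \<le> (1 - f x) * ?T"
      using k' fx by (intro mult_left_mono) auto
    moreover have "f x * (esym S f j + esym S f (Suc j)) \<le> f x * ?T"
      using f insert(1) by (intro mult_left_mono esym_add_le) auto
    ultimately show ?thesis
      unfolding T k esym_insert[OF insert(1,2)] by (simp add: algebra_simps)
  qed
qed

text \<open>Dividing by \<open>r\<close> moves the threshold to 1, and \<open>dom\<close> says that
  \<open>card S - m\<close> successes have probability above 1/2. The two half bounds then squeeze
  the counts of \<open>1 \<le> ?g i\<close> and \<open>1 < ?g i\<close> to this number.\<close>

lemma card_greater_eq_of_dominant_esym:
  assumes "finite S" "\<And>i. i \<in> S \<Longrightarrow> 0 \<le> f i" "0 < r"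
    and dom: "(\<Sum>j\<le>card S. esym S f (card S - j) * r ^ j) < 2 * (esym S f (card S - m) * r ^ m)"
    and "m \<le> card S"
  shows "card {i\<in>S. r < f i} = card S - m"
proof -
  let ?n = "card S" and ?g = "\<lambda>i. inverse r * f i"
  have scale: "esym S ?g (?n - j) * r ^ ?n = esym S f (?n - j) * r ^ j" if "j \<le> ?n" for j
  proof -
    have "r ^ ?n = r ^ (?n - j) * r ^ j" using that by (simp flip: power_add)
    then show ?thesis using assms(3) unfolding esym_scale by (simp add: power_inverse field_simps)
  qed
  \<comment> \<open>The sum is reversed because the power \<open>r ^ j\<close> goes with the
    symmetric sum of degree \<open>?n - j\<close>.\<close>
  have "(\<Prod>i\<in>S. 1 + ?g i) * r ^ ?n = (\<Sum>j\<le>?n. esym S ?g (?n - j)) * r ^ ?n"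
    using sum.nat_diff_reindex[of "esym S ?g" "Suc ?n"] sum_esym[OF assms(1), of ?g]
    by (simp add: lessThan_Suc_atMost)
  also have "\<dots> = (\<Sum>j\<le>?n. esym S f (?n - j) * r ^ j)"
    unfolding sum_distrib_right by (intro sum.cong scale) auto
  also have "\<dots> < 2 * (esym S ?g (?n - m)) * r ^ ?n"
    using dom scale[OF assms(5)] by simp
  finally have gt: "(\<Prod>i\<in>S. 1 + ?g i) < 2 * esym S ?g (?n - m)"
    using assms(3) by simp
  have nn: "\<And>i. i \<in> S \<Longrightarrow> 0 \<le> ?g i" using assms by simp
  have "\<not> ?n - m < card {i\<in>S. 1 \<le> ?g i}" "\<not> card {i\<in>S. 1 < ?g i} < ?n - m"
    using esym_le_half_of_few[of S ?g, OF assms(1) nn] esym_le_half_of_many[of S ?g, OF assms(1) nn] gt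
    by (force simp: not_less[symmetric])+
  moreover have "card {i\<in>S. 1 < ?g i} \<le> card {i\<in>S. 1 \<le> ?g i}"
    using assms(1) by (intro card_mono) auto
  moreover have "{i\<in>S. 1 < ?g i} = {i\<in>S. r < f i}" using assms(3) by (auto simp: field_simps)
  ultimately show ?thesis by simp
qed

section \<open>Gram matrix and singular values\<close>

lemma mat_adjoint_mult_vec:
  fixes A :: "complex mat"
  assumes A: "A \<in> carrier_mat s n" and w: "w \<in> carrier_vec s"
  shows "mat_adjoint A *\<^sub>v w = conjugate (transpose_mat A *\<^sub>v conjugate w)"
proof (intro eq_vecI)
  fix i assume "i < dim_vec (conjugate (transpose_mat A *\<^sub>v conjugate w))"
  then have i: "i < n" using A by simp
  have "(mat_adjoint A *\<^sub>v w) $ i = conjugate (col A i) \<bullet> w"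
    using A i by (simp add: mat_adjoint_def)
  also have "\<dots> = conjugate (col A i \<bullet> conjugate w)"
    using A w i conjugate_sprod_vec[of "col A i" s "conjugate w"] by simp
  finally show "(mat_adjoint A *\<^sub>v w) $ i = conjugate (transpose_mat A *\<^sub>v conjugate w) $ i"
    using A i by simp
qed (use A in \<open>simp add: mat_adjoint_def\<close>)

lemma cscalar_prod_mat_adjoint:
  fixes A :: "complex mat"
  assumes A: "A \<in> carrier_mat s n" and w: "w \<in> carrier_vec s" and v: "v \<in> carrier_vec n"
  shows "(mat_adjoint A *\<^sub>v w) \<bullet>c v = w \<bullet>c (A *\<^sub>v v)"
proof -
  let ?u = "transpose_mat A *\<^sub>v conjugate w"
  have u: "?u \<in> carrier_vec n" using A w by simp
  have "(mat_adjoint A *\<^sub>v w) \<bullet>c v = conjugate (?u \<bullet> v)"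
    using conjugate_sprod_vec[OF u v] mat_adjoint_mult_vec[OF A w] by simp
  also have "?u \<bullet> v = conjugate w \<bullet> (A *\<^sub>v v)"
    using transpose_vec_mult_scalar[OF A v, of "conjugate w"] w by simp
  also have "conjugate \<dots> = w \<bullet>c (A *\<^sub>v v)"
    using A w v by (intro conjugate_conjugate_sprod) auto
  finally show ?thesis .
qed

lemma mat_adjoint_mult_carrier:
  assumes "A \<in> carrier_mat s n"
  shows "mat_adjoint A * A \<in> carrier_mat n n"
  using assms by (auto simp: mat_adjoint_def)

text \<open>For an eigenvector \<open>v\<close>, \<open>z\<close> times the squared norm of
  \<open>v\<close> is the squared norm of \<open>A *\<^sub>v v\<close>. In the order on complex
  numbers, \<open>0 \<le> z\<close> also says that \<open>z\<close> is real.\<close>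

lemma eigenvalue_gram_nonneg:
  fixes A :: "complex mat"
  assumes A: "A \<in> carrier_mat s n" and ev: "eigenvalue (mat_adjoint A * A) z"
  shows "0 \<le> z"
proof -
  have AA: "mat_adjoint A \<in> carrier_mat n s" using A by (auto simp: mat_adjoint_def)
  obtain v where "eigenvector (mat_adjoint A * A) v z"
    using ev by (auto simp: eigenvalue_def)
  then have v: "v \<in> carrier_vec n" "v \<noteq> 0\<^sub>v n" "(mat_adjoint A * A) *\<^sub>v v = z \<cdot>\<^sub>v v"
    using A AA by (auto simp: eigenvector_def)
  have "z * (v \<bullet>c v) = ((mat_adjoint A * A) *\<^sub>v v) \<bullet>c v" using v by simp
  also have "\<dots> = (A *\<^sub>v v) \<bullet>c (A *\<^sub>v v)"
    using cscalar_prod_mat_adjoint[OF A _ v(1), of "A *\<^sub>v v"] A AA v(1) by simp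
  finally have "0 \<le> z * (v \<bullet>c v)" by auto
  moreover have "0 < v \<bullet>c v" using v by simp
  ultimately show ?thesis
    by (auto simp: less_eq_complex_def less_complex_def zero_le_mult_iff)
qed

text \<open>A complex polynomial of degree \<open>n\<close> has \<open>n\<close> roots with
  multiplicity; this puts the indices \<open>1..n\<close> of \<open>sing_val\<close> in
  range.\<close>

lemma length_singular_values:
  assumes "M \<in> carrier_mat s n"
  shows "length (singular_values M) = n"
proof -
  have "size (proots (char_poly (mat_adjoint M * M))) = n"
    using degree_monic_char_poly[OF mat_adjoint_mult_carrier[OF assms]] by (simp add: size_proots_complex)
  moreover have "length (singular_values M) = size (mset (singular_values M))" by simp
  ultimately show ?thesis unfolding singular_values_def by (simp del: size_mset)
qed

lemma sing_val_antimono: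
  assumes "M \<in> carrier_mat s n" "1 \<le> i" "i \<le> j" "j \<le> n"
  shows "sing_val M j \<le> sing_val M i"
proof -
  have "sorted (rev (singular_values M))" unfolding singular_values_def by simp
  then show ?thesis
    using length_singular_values[OF assms(1)] assms unfolding sing_val_def
    by (simp add: sorted_rev_iff_nth_mono)
qed

text \<open>Since \<open>sqrt\<close> is negative at negative arguments, this rests on
  \<open>eigenvalue_gram_nonneg\<close>.\<close>

lemma sing_val_nonneg:
  assumes "M \<in> carrier_mat s n" "i \<in> {1..n}"
  shows "0 \<le> sing_val M i"
proof -
  let ?p = "char_poly (mat_adjoint M * M)"
  have "sing_val M i \<in> set (singular_values M)"
    unfolding sing_val_def using length_singular_values[OF assms(1)] assms(2) by (intro nth_mem) auto
  also have "set (singular_values M) = set_mset (mset (singular_values M))" by simp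
  also have "\<dots> = (\<lambda>z. sqrt (Re z)) ` set_mset (proots ?p)" unfolding singular_values_def
    by (simp del: set_mset_mset)
  finally obtain z where z: "z \<in># proots ?p" "sing_val M i = sqrt (Re z)" by auto
  have "poly ?p z = 0" using z(1) by (cases "?p = 0") auto
  then have "0 \<le> z"
    using eigenvalue_root_char_poly[OF mat_adjoint_mult_carrier[OF assms(1)]] eigenvalue_gram_nonneg[OF assms(1)] by blast
  then show ?thesis using z by (simp add: less_eq_complex_def)
qed

lemma sym_sv_eq_esym:
  "M \<in> carrier_mat s n \<Longrightarrow> sym_sv M k = esym {1..n} (sing_val M) k"
  unfolding sym_sv_def esym_def by auto


section \<open>Domination by geometric series\<close>

lemma sum_powers_less:
  fixes x :: real
  assumes "0 < x" "x < 1"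
  shows "(\<Sum>j=1..N. x ^ j) < x / (1 - x)"
proof -
  have "(\<Sum>j=1..N. x ^ j) * (1 - x) = x - x ^ Suc N"
    by (induction N) (simp_all add: distrib_right right_diff_distrib)
  also have "\<dots> < x" using assms by simp
  finally show ?thesis using assms by (simp add: field_simps)
qed

text \<open>In units of \<open>t m\<close>, the terms below and above \<open>m\<close> stay strictly
  under full geometric series of ratios \<open>x\<close> and \<open>u\<close>, which by
  \<open>le\<close> total at most 1.\<close>

lemma sum_less_twice_dominant_term:
  fixes t :: "nat \<Rightarrow> real"
  assumes "m \<le> n" "0 < t m" "0 < x" "x < 1" "0 < u" "u < 1"
    and le: "x / (1 - x) + u / (1 - u) \<le> 1"
    and low: "\<And>i. i < m \<Longrightarrow> t i \<le> t m * x ^ (m - i)"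
    and high: "\<And>i. m < i \<Longrightarrow> i \<le> n \<Longrightarrow> t i \<le> t m * u ^ (i - m)"
  shows "(\<Sum>i\<le>n. t i) < 2 * t m"
proof -
  have "{..n} = insert m ({..<m} \<union> {m<..n})" using assms(1) by auto
  moreover have "sum t ({..<m} \<union> {m<..n}) = (\<Sum>i<m. t i) + (\<Sum>i\<in>{m<..n}. t i)"
    by (intro sum.union_disjoint) auto
  ultimately have "(\<Sum>i\<le>n. t i) = t m + ((\<Sum>i<m. t i) + (\<Sum>i\<in>{m<..n}. t i))"
    by simp
  moreover have "(\<Sum>i<m. t i) < t m * (x / (1 - x))"
  proof -
    have "(\<Sum>i<m. t i) \<le> (\<Sum>i<m. t m * x ^ (m - i))" using low by (intro sum_mono) auto
    also have "\<dots> = t m * (\<Sum>i<m. x ^ (m - i))" by (simp add: sum_distrib_left)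
    also have "(\<Sum>i<m. x ^ (m - i)) = (\<Sum>j=1..m. x ^ j)"
      by (rule sum.reindex_bij_witness[of _ "\<lambda>j. m - j" "\<lambda>i. m - i"]) auto
    also have "t m * \<dots> < t m * (x / (1 - x))"
      using sum_powers_less[of x m] assms by (intro mult_strict_left_mono) auto
    finally show ?thesis .
  qed
  moreover have "(\<Sum>i\<in>{m<..n}. t i) < t m * (u / (1 - u))"
  proof -
    have "(\<Sum>i\<in>{m<..n}. t i) \<le> (\<Sum>i\<in>{m<..n}. t m * u ^ (i - m))"
      using high by (intro sum_mono) auto
    also have "\<dots> = t m * (\<Sum>i\<in>{m<..n}. u ^ (i - m))" by (simp add: sum_distrib_left)
    also have "(\<Sum>i\<in>{m<..n}. u ^ (i - m)) = (\<Sum>j=1..n-m. u ^ j)"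
      by (rule sum.reindex_bij_witness[of _ "\<lambda>j. j + m" "\<lambda>i. i - m"]) auto
    also have "t m * \<dots> < t m * (u / (1 - u))"
      using sum_powers_less[of u "n - m"] assms by (intro mult_strict_left_mono) auto
    finally show ?thesis .
  qed
  moreover have "t m * (x / (1 - x)) + t m * (u / (1 - u)) \<le> t m"
    using mult_left_mono[OF le, of "t m"] assms(2) by (simp add: distrib_left)
  ultimately show ?thesis by linarith
qed

text \<open>The radius \<open>u\<close> is the smaller root of \<open>2 u\<^sup>2 - (3 a + 1) u + 2 a\<close>; this polynomial is obtained by
  clearing denominators in \<open>x / (1 - x) + u / (1 - u) = 1\<close> with \<open>x = a / u\<close>.\<close>

lemma cluster_radius:
  fixes a :: real
  assumes "0 < a" "a < 1/9"
  defines "u \<equiv> (3 * a + 1 - sqrt ((3 * a + 1)^2 - 16 * a)) / 4"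
  shows "a < u" "u < 1" "(a / u) / (1 - a / u) + u / (1 - u) = 1"
proof -
  let ?D = "(3 * a + 1)^2 - 16 * a"
  \<comment> \<open>The source of 1/9: for \<open>a < 1\<close> the discriminant is nonnegative
    exactly when \<open>a \<le> 1/9\<close>.\<close>
  have "?D = (1 - 9 * a) * (1 - a)" by (simp add: power2_eq_square algebra_simps)
  then have D: "0 \<le> ?D" using assms by simp
  \<comment> \<open>This is \<open>(1 - a)^2 - ?D\<close>; its positivity leads to
    \<open>a < u\<close>.\<close>
  have "0 < 8 * (a * (1 - a))" using assms by simp
  then have "?D < (1 - a)^2" by (simp add: power2_eq_square algebra_simps)
  then have "sqrt ?D < 1 - a" using assms real_less_lsqrt by simp
  then show au: "a < u" unfolding u_def by simp
  have "0 \<le> sqrt ?D" using D by simp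
  then have "3 * a + 1 - sqrt ?D < 4" using assms(2) by linarith
  then show u1: "u < 1" unfolding u_def by simp
  have "sqrt ?D = 3 * a + 1 - 4 * u" proof -
    have "y = b - 4 * ((b - y) / 4)" for y b :: real by (simp add: diff_divide_distrib)
    then show ?thesis unfolding u_def .
  qed
  then have "?D = (3 * a + 1 - 4 * u)^2" using real_sqrt_pow2[OF D] by simp
  then have "2 * u^2 - (3 * a + 1) * u + 2 * a = 0" by (simp add: power2_eq_square algebra_simps)
  then have key: "a * (1 - u) + u * (u - a) = (u - a) * (1 - u)"
    by (simp add: power2_eq_square algebra_simps)
  have x: "(a / u) / (1 - a / u) = a / (u - a)" using assms(1) au by (simp add: field_simps)
  have "a / (u - a) + u / (1 - u) = (a * (1 - u) + u * (u - a)) / ((u - a) * (1 - u))"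
    using au u1 by (simp add: add_frac_eq)
  also have "\<dots> = 1" unfolding key using au u1 by simp
  finally show "(a / u) / (1 - a / u) + u / (1 - u) = 1" unfolding x .
qed

text \<open>With \<open>r = u / g\<close> the ratios become \<open>b / r = a / u\<close> below
  \<open>m\<close> and \<open>g * r = u\<close> above, and \<open>u\<close> is chosen so that the
  two series total exactly 1.\<close>

lemma dominant_term_at_cluster_radius:
  fixes c :: "nat \<Rightarrow> real"
  assumes "m \<le> n" "0 < c m" "0 < b" "0 < g" "b * g < 1/9"
    and low: "\<And>i. i < m \<Longrightarrow> c i \<le> c m * b ^ (m - i)"
    and high: "\<And>i. m < i \<Longrightarrow> i \<le> n \<Longrightarrow> c i \<le> c m * g ^ (i - m)"
  defines "a \<equiv> b * g"
  defines "r \<equiv> (3 * a + 1 - sqrt ((3 * a + 1)^2 - 16 * a)) / (4 * g)"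
  shows "0 < r" "(\<Sum>i\<le>n. c i * r ^ i) < 2 * (c m * r ^ m)"
proof -
  define u where "u = (3 * a + 1 - sqrt ((3 * a + 1)^2 - 16 * a)) / 4"
  have a: "0 < a" "a < 1/9" using assms unfolding a_def by auto
  note u = cluster_radius[OF a, folded u_def]
  have r: "r = u / g" unfolding r_def u_def by simp
  show r0: "0 < r" using u a assms(4) unfolding r by simp
  have x: "a / u = b / r" "g * r = u" using assms(4) unfolding r a_def by auto
  show "(\<Sum>i\<le>n. c i * r ^ i) < 2 * (c m * r ^ m)"
  proof (rule sum_less_twice_dominant_term[where x = "a / u" and u = u])
    fix i assume i: "i < m"
    have "c i * r ^ i \<le> c m * b ^ (m - i) * r ^ i"
      using low[OF i] r0 by (intro mult_right_mono) auto
    also have "b ^ (m - i) * r ^ i = r ^ m * (a / u) ^ (m - i)"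
      using i r0 unfolding x power_divide by (simp add: field_simps flip: power_add)
    then have "c m * b ^ (m - i) * r ^ i = c m * r ^ m * (a / u) ^ (m - i)"
      by (simp add: mult.assoc)
    finally show "c i * r ^ i \<le> c m * r ^ m * (a / u) ^ (m - i)" .
  next
    fix i assume i: "m < i" "i \<le> n"
    have "c i * r ^ i \<le> c m * g ^ (i - m) * r ^ i"
      using high[OF i] r0 by (intro mult_right_mono) auto
    also have "c m * g ^ (i - m) * r ^ i = c m * g ^ (i - m) * (r ^ m * r ^ (i - m))"
      using i by (simp flip: power_add)
    also have "\<dots> = c m * r ^ m * u ^ (i - m)"
      unfolding x(2)[symmetric] power_mult_distrib by simp
    finally show "c i * r ^ i \<le> c m * r ^ m * u ^ (i - m)" .
  next
    show "(a / u) / (1 - a / u) + u / (1 - u) \<le> 1" using u(3) by simp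
  qed (use assms(1,2) u(1,2) a(1) r0 in auto)
qed

section \<open>Coefficient bounds from \<open>b_coeff\<close> and \<open>g_coeff\<close>\<close>

lemma le_mult_power_of_powr_le:
  fixes c d b :: real
  assumes "0 \<le> c" "0 < d" "0 < k" "(c / d) powr (1 / real k) \<le> b"
  shows "c \<le> d * b ^ k"
proof -
  \<comment> \<open>Zero is split off because \<open>powr_realpow\<close> asks for a positive
    base.\<close>
  have "c / d = ((c / d) powr (1 / real k)) ^ k"
    using assms by (cases "c = 0") (simp_all flip: powr_realpow add: powr_powr)
  also have "\<dots> \<le> b ^ k" using assms by (intro power_mono) auto
  finally show ?thesis using assms by (simp add: field_simps)
qed

lemma sym_sv_nonneg:
  assumes "M \<in> carrier_mat s n"
  shows "0 \<le> sym_sv M k"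
  unfolding sym_sv_eq_esym[OF assms] using sing_val_nonneg[OF assms] by (rule esym_nonneg)

lemma b_coeff_ge:
  assumes "M \<in> carrier_mat s n" "i < k"
  shows "(sym_sv M (n - i) / sym_sv M (n - k)) powr (1 / real (k - i)) \<le> b_coeff M k"
  unfolding b_coeff_def Let_def using assms by (auto intro!: cSUP_upper)

lemma g_coeff_ge:
  assumes "M \<in> carrier_mat s n" "k < i" "i \<le> n"
  shows "(sym_sv M (n - i) / sym_sv M (n - k)) powr (1 / real (i - k)) \<le> g_coeff M k"
  unfolding g_coeff_def Let_def using assms by (auto intro!: cSUP_upper)

lemma b_coeff_bound:
  assumes "M \<in> carrier_mat s n" "sym_sv M (n - k) \<noteq> 0" "i < k"
  shows "sym_sv M (n - i) \<le> sym_sv M (n - k) * b_coeff M k ^ (k - i)"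
  using sym_sv_nonneg[OF assms(1)] assms b_coeff_ge[OF assms(1,3)]
  by (intro le_mult_power_of_powr_le) (auto simp: less_le)

lemma g_coeff_bound:
  assumes "M \<in> carrier_mat s n" "sym_sv M (n - k) \<noteq> 0" "k < i" "i \<le> n"
  shows "sym_sv M (n - i) \<le> sym_sv M (n - k) * g_coeff M k ^ (i - k)"
  using sym_sv_nonneg[OF assms(1)] assms g_coeff_ge[OF assms(1,3,4)]
  by (intro le_mult_power_of_powr_le) (auto simp: less_le)

lemma b_coeff_nonneg:
  assumes "M \<in> carrier_mat s n" "1 \<le> k"
  shows "0 \<le> b_coeff M k"
  using b_coeff_ge[OF assms(1), of 0 k] assms(2) by (auto intro: order_trans[OF powr_ge_zero])

text \<open>For \<open>k < n\<close> the index \<open>i = n\<close> contributes a positive power,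
  since \<open>sym_sv M 0 = 1\<close>.\<close>

lemma g_coeff_pos:
  assumes "M \<in> carrier_mat s n" "k \<le> n" "sym_sv M (n - k) \<noteq> 0"
  shows "0 < g_coeff M k"
proof (cases "k = n")
  case True
  then show ?thesis using assms by (simp add: g_coeff_def)
next
  case False
  have "sym_sv M 0 = 1" unfolding sym_sv_eq_esym[OF assms(1)] by simp
  then have "0 < (sym_sv M (n - n) / sym_sv M (n - k)) powr (1 / real (n - k))"
    using assms(3) by simp
  also have "\<dots> \<le> g_coeff M k" using False assms(2) by (intro g_coeff_ge[OF assms(1)]) auto
  finally show ?thesis .
qed

section \<open>Rank from counts and from vanishing symmetric sums\<close>

text \<open>Singular values decrease, so the indices with value above \<open>e\<close> form an
  initial segment, determined by its cardinality.\<close>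

lemma has_eps_rankI_card:
  assumes M: "M \<in> carrier_mat s n" and "0 \<le> e" "card {i\<in>{1..n}. e < sing_val M i} = r"
  shows "has_eps_rank M e r"
proof -
  let ?A = "{i\<in>{1..n}. e < sing_val M i}"
  have "card ?A \<le> card {1..n}" by (intro card_mono) auto
  then have r: "r \<le> n" using assms(3) by simp
  have down: "j \<in> ?A" if "i \<in> ?A" "1 \<le> j" "j \<le> i" for i j
    using sing_val_antimono[OF M that(2,3)] that by auto
  have "?A \<subseteq> {1..r}"
  proof
    fix i assume i: "i \<in> ?A"
    have "card {1..i} \<le> card ?A" using down[OF i] by (intro card_mono) auto
    then show "i \<in> {1..r}" using i assms(3) by auto
  qed
  then have "?A = {1..r}" using assms(3) by (intro card_subset_eq) auto
  then have iff: "i \<in> {1..r} \<longleftrightarrow> e < sing_val M i" if "i \<in> {1..n}" for i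
    using that by blast
  have "e < sing_val M i" if "i \<in> {1..r}" for i using iff[of i] that r by simp
  moreover have "sing_val M i \<le> e" if "i \<in> {r + 1..n}" for i using iff[of i] that by simp
  ultimately show ?thesis unfolding has_eps_rank_def using assms(2) r M by simp
qed

text \<open>Every \<open>k\<close>-subset has an element that is at least \<open>i\<close>, so a
  vanishing value at \<open>i\<close> would kill every product in the sum.\<close>

lemma sing_val_pos_of_sym_sv:
  assumes M: "M \<in> carrier_mat s n" and "sym_sv M k \<noteq> 0" "i \<in> {1..k}"
  shows "0 < sing_val M i"
proof (rule ccontr)
  assume neg: "\<not> 0 < sing_val M i"
  have "prod (sing_val M) I = 0" if I: "I \<subseteq> {1..n}" "card I = k" for I
  proof -
    have "\<not> I \<subseteq> {1..<i}"
      using card_mono[of "{1..<i}" I] I(2) assms(3) by auto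
    then obtain j where "j \<in> I" "i \<le> j" "j \<le> n" using I(1) by fastforce
    then have "sing_val M j = 0"
      using neg sing_val_antimono[OF M, of i j] sing_val_nonneg[OF M, of j] assms(3) I(1) by fastforce
    then show ?thesis using \<open>j \<in> I\<close> I(1) finite_subset by fastforce
  qed
  then have "sym_sv M k = 0" unfolding sym_sv_eq_esym[OF M] esym_def by simp
  then show False using assms(2) by simp
qed

text \<open>Otherwise the product of the first \<open>k\<close> singular values would be a positive
  summand of a sum of nonnegative terms.\<close>

lemma sing_val_eq_0_of_sym_sv:
  assumes M: "M \<in> carrier_mat s n" and "sym_sv M k = 0" "k \<le> i" "i \<in> {1..n}"
  shows "sing_val M i = 0"
proof (rule ccontr)
  assume nz: "sing_val M i \<noteq> 0"
  have pos: "0 < sing_val M j" if "j \<in> {1..k}" for j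
    using nz that sing_val_antimono[OF M, of j i] sing_val_nonneg[OF M assms(4)] assms by auto
  have sub: "{1..k} \<subseteq> {1..n}" using assms by auto
  have "prod (sing_val M) {1..k} \<le> esym {1..n} (sing_val M) k"
    unfolding esym_def using sub sing_val_nonneg[OF M]
    by (intro member_le_sum) (auto intro!: prod_nonneg)
  moreover have "0 < prod (sing_val M) {1..k}" using pos by (intro prod_pos) auto
  ultimately show False using assms(2) unfolding sym_sv_eq_esym[OF M] by simp
qed

section \<open>The two rank statements\<close>

lemma has_eps_rank_cluster:
  assumes M: "M \<in> carrier_mat s n" and m: "1 \<le> m" "m \<le> n" "sym_sv M (n - m) \<noteq> 0"
    and lt: "a_coeff M m < 1/9"
  defines "a \<equiv> a_coeff M m"
  shows "has_eps_rank M ((3 * a + 1 - sqrt ((3 * a + 1)^2 - 16 * a)) / (4 * g_coeff M m)) (n - m)"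
    (is "has_eps_rank M ?e _")
proof (cases "b_coeff M m = 0")
  \<comment> \<open>Here the radius is 0, out of reach of the dominance argument, which divides by
    \<open>r\<close>. The claim becomes that exactly the last \<open>m\<close> singular values
    vanish.\<close>
  case True
  then have a: "a = 0" unfolding a_def a_coeff_def by simp
  have "sym_sv M (n - (m - 1)) = 0"
    using b_coeff_bound[OF M m(3), of "m - 1"] True m(1) sym_sv_nonneg[OF M, of "n - (m - 1)"] by simp
  then have zero: "sing_val M i = 0" if "i \<in> {n - m + 1..n}" for i
    using that m by (intro sing_val_eq_0_of_sym_sv[OF M]) auto
  have pos: "0 < sing_val M i" if "i \<in> {1..n - m}" for i
    using sing_val_pos_of_sym_sv[OF M m(3) that] .
  show ?thesis unfolding a has_eps_rank_def using M zero pos by simp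
next
  case False
  have b: "0 < b_coeff M m" using False b_coeff_nonneg[OF M m(1)] by simp
  have g: "0 < g_coeff M m" using g_coeff_pos[OF M m(2,3)] .
  have c: "0 < sym_sv M (n - m)" using m(3) sym_sv_nonneg[OF M, of "n - m"] by simp
  note dom = dominant_term_at_cluster_radius[where c = "\<lambda>i. sym_sv M (n - i)",
      OF m(2) c b g lt[unfolded a_coeff_def] b_coeff_bound[OF M m(3)] g_coeff_bound[OF M m(3)],
      folded a_coeff_def, folded a_def]
  have "card {i\<in>{1..n}. ?e < sing_val M i} = card {1..n} - m"
    using dom m(2) sing_val_nonneg[OF M]
    by (intro card_greater_eq_of_dominant_esym) (auto simp: sym_sv_eq_esym[OF M])
  then show ?thesis using dom(1) by (intro has_eps_rankI_card[OF M]) auto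
qed

text \<open>The product of all singular values but the last is one summand of
  \<open>sym_sv M (n - 1)\<close>.\<close>

lemma b_coeff_1_le_sing_val:
  assumes M: "M \<in> carrier_mat s n" and "1 \<le> n" "sym_sv M (n - 1) \<noteq> 0"
  shows "b_coeff M 1 \<le> sing_val M n"
proof -
  let ?P = "prod (sing_val M) {1..<n}"
  have nn: "0 \<le> sing_val M n" using sing_val_nonneg[OF M] assms(2) by simp
  have ins: "{1..n} = insert n {1..<n}" using assms(2) by auto
  have "sym_sv M n = prod (sing_val M) {1..n}"
    using esym_card[of "{1..n}" "sing_val M"] sym_sv_eq_esym[OF M] by simp
  also have "\<dots> = sing_val M n * ?P" unfolding ins by simp
  finally have "sym_sv M n = sing_val M n * ?P" .
  moreover have "?P \<le> sym_sv M (n - 1)"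
    unfolding sym_sv_eq_esym[OF M] esym_def using sing_val_nonneg[OF M]
    by (intro member_le_sum) (auto intro!: prod_nonneg)
  ultimately have le: "sym_sv M n \<le> sing_val M n * sym_sv M (n - 1)"
    using nn by (simp add: mult_left_mono)
  have c: "0 < sym_sv M (n - 1)" using assms(3) sym_sv_nonneg[OF M, of "n - 1"] by simp
  \<comment> \<open>For \<open>k = 1\<close> the supremum has the single index 0, with exponent
    1.\<close>
  have "b_coeff M 1 = sym_sv M n / sym_sv M (n - 1)"
    using M sym_sv_nonneg[OF M] by (simp add: b_coeff_def)
  also have "\<dots> \<le> sing_val M n" using le c by (simp add: divide_le_eq)
  finally show ?thesis .
qed

text \<open>The smallest singular value is at least \<open>b_coeff M 1\<close>, which exceeds
  \<open>1 / (10 * g_coeff M 1)\<close> because 1/9 > 1/10.\<close>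

lemma has_eps_rank_full:
  assumes M: "M \<in> carrier_mat s n" and n: "1 \<le> n" "sym_sv M (n - 1) \<noteq> 0"
    and gt: "1/9 < a_coeff M 1"
  shows "has_eps_rank M (1 / (10 * g_coeff M 1)) n"
proof -
  have g: "0 < g_coeff M 1" using g_coeff_pos[OF M n] .
  have "1 / 10 < b_coeff M 1 * g_coeff M 1" using gt unfolding a_coeff_def by simp
  also have "\<dots> \<le> sing_val M n * g_coeff M 1"
    using b_coeff_1_le_sing_val[OF M n] g by (intro mult_right_mono) auto
  finally have "1 / (10 * g_coeff M 1) < sing_val M n" using g by (simp add: field_simps)
  then have "1 / (10 * g_coeff M 1) < sing_val M i" if "i \<in> {1..n}" for i
    using sing_val_antimono[OF M, of i n] that by force
  then show ?thesis using g M unfolding has_eps_rank_def by simp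
qed

theorem mainTheorem2:
  fixes s n :: nat and M :: "complex mat"
  assumes "1 \<le> n" and "n \<le> s" and "M \<in> carrier_mat s n"
  shows
    "((\<exists>m'. 1 \<le> m' \<and> m' \<le> n \<and> sym_sv M (n - m') \<noteq> 0 \<and> a_coeff M m' < 1/9) \<longrightarrow>
        (let m = (LEAST m. 1 \<le> m \<and> m \<le> n \<and> sym_sv M (n - m) \<noteq> 0 \<and> a_coeff M m < 1/9);
             a = a_coeff M m
         in has_eps_rank M
              ((3 * a + 1 - sqrt ((3 * a + 1)^2 - 16 * a)) / (4 * g_coeff M m)) (n - m)))
     \<and>
     (sym_sv M (n - 1) \<noteq> 0 \<and> a_coeff M 1 > 1/9 \<longrightarrow>
        (let m = (THE m. 1 \<le> m \<and> m \<le> n \<and>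
                    (\<forall>k\<in>{1..m - 1}. sym_sv M (n - k) = 0) \<and> sym_sv M (n - m) \<noteq> 0)
         in has_eps_rank M (1 / (10 * g_coeff M m)) n))"
proof (intro conjI impI)
  let ?P = "\<lambda>m. 1 \<le> m \<and> m \<le> n \<and> sym_sv M (n - m) \<noteq> 0 \<and> a_coeff M m < 1/9"
  assume "\<exists>m. ?P m"
  then have "?P (LEAST m. ?P m)" by (rule LeastI_ex)
  then show "let m = (LEAST m. ?P m); a = a_coeff M m
    in has_eps_rank M
      ((3 * a + 1 - sqrt ((3 * a + 1)^2 - 16 * a)) / (4 * g_coeff M m)) (n - m)"
    unfolding Let_def by (intro has_eps_rank_cluster[OF assms(3)]) auto
next
  let ?Q = "\<lambda>m. 1 \<le> m \<and> m \<le> n \<and>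
    (\<forall>k\<in>{1..m - 1}. sym_sv M (n - k) = 0) \<and> sym_sv M (n - m) \<noteq> 0"
  assume *: "sym_sv M (n - 1) \<noteq> 0 \<and> a_coeff M 1 > 1/9"
  \<comment> \<open>At \<open>m = 1\<close> the range \<open>{1..m - 1}\<close> is empty; any larger
    \<open>m\<close> would force \<open>sym_sv M (n - 1) = 0\<close>.\<close>
  have "(THE m. ?Q m) = 1"
  proof (rule the_equality)
    fix m assume Q: "?Q m"
    show "m = 1"
    proof (rule ccontr)
      assume "m \<noteq> 1"
      then have "1 \<in> {1..m - 1}" using Q by auto
      then show False using Q * by blast
    qed
  qed (use * assms(1) in auto)
  then show "let m = (THE m. ?Q m) in has_eps_rank M (1 / (10 * g_coeff M m)) n"
    using has_eps_rank_full[OF assms(3,1)] * by simp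
qed

end
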